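(* Let $t,\ell,m$ be integers with $1 \le t \le \ell \le m$. Then the minimum distance of the determinantal code $\widehat{C}_{\det}(t;\ell,m)$ equals $$q^{\ell+m-2}\,\nu_{t-1}(\ell-1,m-1).$$
   Context: $q$ is a prime power. For nonnegative integers $a,b,t$, $\nu_t(a,b)$ is the number of $a\times b$ matrices over $\mathbb{F}_q$ of rank at most $t$. Let $\widehat{\mathcal D}_t(\ell,m)\subset\mathbb{P}^{\ell m-1}(\mathbb{F}_q)=\mathbb{P}(\mathrm{Mat}_{\ell\times m}(\mathbb{F}_q))$ be the set of points $[M]$ with $M\ne 0$ and $\mathrm{rk}(M)\le t$; let $\hat n=|\widehat{\mathcal D}_t(\ell,m)|$, enumerate its points $P_1,\dots,P_{\hat n}$ and choose representatives $M_i\in\mathrm{Mat}_{\ell\times m}(\mathbb{F}_q)$ of $P_i$. The determinantal code $\widehat{C}_{\det}(t;\ell,m)\subseteq\mathbb{F}_q^{\hat n}$ is the image of the map sending a linear form $f=\sum_{i,j}f_{ij}X_{ij}$ (with $X=(X_{ij})$ an $\ell\times m$ matrix of indeterminates) to $(f(M_1),\dots,f(M_{\hat n}))$. Its minimum distance is the smallest Hamming weight of a nonzero codeword. *)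

theory Defs
  imports "Jordan_Normal_Form.DL_Rank"
begin

definition mat_rank :: "'a::field mat \<Rightarrow> nat" where
  "mat_rank A = vec_space.rank (dim_row A) A"

definition nu :: "'a::{finite,field} itself \<Rightarrow> nat \<Rightarrow> nat \<Rightarrow> nat \<Rightarrow> nat" where
  "nu ty t a b = card {M :: 'a mat. M \<in> carrier_mat a b \<and> mat_rank M \<le> t}"

definition proj_point :: "'a::field mat \<Rightarrow> 'a mat set" where
  "proj_point M = {c \<cdot>\<^sub>m M | c. c \<noteq> 0}"

definition det_points :: "'a::{finite,field} itself \<Rightarrow> nat \<Rightarrow> nat \<Rightarrow> nat \<Rightarrow> 'a mat set set" where
  "det_points ty t l m =
     proj_point ` {M :: 'a mat. M \<in> carrier_mat l m \<and> M \<noteq> 0\<^sub>m l m \<and> mat_rank M \<le> t}"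

definition rep :: "'a mat set \<Rightarrow> 'a mat" where
  "rep P = (SOME M. M \<in> P)"

definition lin_form :: "'a::field mat \<Rightarrow> 'a mat \<Rightarrow> 'a" where
  "lin_form F M = (\<Sum>i<dim_row F. \<Sum>j<dim_col F. F $$ (i, j) * M $$ (i, j))"

(* the determinantal code: codewords are vectors indexed by the points of det_points
   (coordinates outside the index set are fixed to 0) *)
definition det_code :: "'a::{finite,field} itself \<Rightarrow> nat \<Rightarrow> nat \<Rightarrow> nat \<Rightarrow> ('a mat set \<Rightarrow> 'a) set" where
  "det_code ty t l m =
     {(\<lambda>P. if P \<in> det_points ty t l m then lin_form F (rep P) else 0) | F. F \<in> carrier_mat l m}"

definition hweight :: "'a::{finite,field} itself \<Rightarrow> nat \<Rightarrow> nat \<Rightarrow> nat \<Rightarrow> ('a mat set \<Rightarrow> 'a) \<Rightarrow> nat" where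
  "hweight ty t l m c = card {P \<in> det_points ty t l m. c P \<noteq> 0}"

definition det_min_dist :: "'a::{finite,field} itself \<Rightarrow> nat \<Rightarrow> nat \<Rightarrow> nat \<Rightarrow> nat" where
  "det_min_dist ty t l m = Min {hweight ty t l m c | c. c \<in> det_code ty t l m \<and> c \<noteq> (\<lambda>_. 0)}"

end

(*
  Let F be a nonzero linear form and f one of its nonzero columns, in position j.  Fixing all columns
  of M but the j-th, the admissible j-th columns are closed under differences (they are everything,
  a subspace, or nothing), so that F(M) = 0 has at most as many solutions as f . col_j(M) = 0.
  Row and column operations turn the latter equation into M_{00} = 0, whence the weight of
  F is at least that of the form X_{00}.  The matrices of rank at most t with M_{00} = a nonzero are
  given by the first row, the first column and a Schur complement of rank at most t - 1.
  Over a finite field the rank is read off from the cardinality q^rank of the range.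
*)
theory Submission
  imports Defs "Jordan_Normal_Form.Schur_Decomposition" "HOL-Library.Cardinality"
begin

section \<open>Rank and the cardinality of the range\<close>

text \<open>A finite basis gives every vector a unique coordinate function, so vectors correspond
  bijectively to functions from the basis to the scalars.\<close>

lemma (in vectorspace) card_carrier_eq_power_dim:
  assumes fin_dim
  shows "card (carrier V) = card (carrier K) ^ dim"
proof -
  obtain B where B: "finite B" "basis B"
    using finite_basis_exists[OF assms] by blast
  then have BV: "B \<subseteq> carrier V"
    by (simp add: basis_def)
  have *: "\<exists>!a. a \<in> B \<rightarrow>\<^sub>E carrier K \<and> lincomb a B = v" if "v \<in> carrier V" for v
    using basis_criterion[OF B(1) BV] B(2) that by blast
  have "bij_betw (\<lambda>a. lincomb a B) (B \<rightarrow>\<^sub>E carrier K) (carrier V)"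
  proof (rule bij_betw_imageI)
    have closed: "lincomb a B \<in> carrier V" if "a \<in> B \<rightarrow>\<^sub>E carrier K" for a
      using that BV by (intro lincomb_closed) auto
    then show "inj_on (\<lambda>a. lincomb a B) (B \<rightarrow>\<^sub>E carrier K)"
      using * by (intro inj_onI) blast
    show "(\<lambda>a. lincomb a B) ` (B \<rightarrow>\<^sub>E carrier K) = carrier V"
      using closed * by blast
  qed
  then have "card (carrier V) = card (B \<rightarrow>\<^sub>E carrier K)"
    by (simp add: bij_betw_same_card)
  also have "\<dots> = card (carrier K) ^ card B"
    by (rule card_funcsetE[OF B(1)])
  finally show ?thesis
    using dim_basis[OF B] by simp
qed

text \<open>The column space as a bare set. Over a finite field its cardinality determines the rank,
  so the rank arguments below become counting arguments about this set.\<close>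

definition mat_range :: "'a::field mat \<Rightarrow> 'a vec set" where
  "mat_range A = (\<lambda>v. A *\<^sub>v v) ` carrier_vec (dim_col A)"

lemma card_field_gt_1: "1 < CARD('a::{finite,field})"
  using card_mono[of "UNIV :: 'a set" "{0, 1}"] by simp

text \<open>The range is the span of the columns, and the rank is by definition the dimension of
  that span; the count of vectors by dimension then applies.\<close>

lemma card_mat_range: "card (mat_range (A :: 'a::{finite,field} mat)) = CARD('a) ^ mat_rank A"
proof -
  interpret vec_space "TYPE('a)" "dim_row A" .
  let ?W = "span_vs (set (cols A))"
  have A: "A \<in> carrier_mat (dim_row A) (dim_col A)"
    by simp
  have "set (cols A) \<subseteq> carrier V"
    using cols_dim[of A] by simp
  then have "vectorspace class_ring ?W"
    using span_is_subspace subspace_def subspace_is_vs by simp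
  then have "card (carrier ?W) = card (carrier (class_ring :: 'a ring)) ^ vectorspace.dim class_ring ?W"
    using vectorspace.card_carrier_eq_power_dim fin_dim_span_cols[OF A] by blast
  moreover have "carrier ?W = mat_range A"
    using col_space_eq[OF A] mult_mat_vec_carrier[OF A] by (auto simp: col_space_def mat_range_def)
  ultimately show ?thesis
    by (simp add: mat_rank_def rank_def class_ring_simps)
qed

lemma mat_rank_le_iff: "mat_rank (A :: 'a::{finite,field} mat) \<le> t \<longleftrightarrow> card (mat_range A) \<le> CARD('a) ^ t"
  using card_field_gt_1[where 'a='a] by (simp add: card_mat_range power_increasing_iff)

lemma finite_vec: "finite (carrier_vec n :: 'a::finite vec set)"
  and card_vec: "card (carrier_vec n :: 'a::finite vec set) = CARD('a) ^ n"
proof -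
  have "bij_betw (\<lambda>f. vec n f) ({..<n} \<rightarrow>\<^sub>E (UNIV :: 'a set)) (carrier_vec n)"
  proof (rule bij_betwI[where g = "\<lambda>v. \<lambda>i\<in>{..<n}. v $ i"])
    show "(\<lambda>i\<in>{..<n}. vec n f $ i) = f" if "f \<in> {..<n} \<rightarrow>\<^sub>E (UNIV :: 'a set)" for f
      using that by (auto simp: fun_eq_iff PiE_iff extensional_def)
  qed auto
  from bij_betw_finite[OF this] bij_betw_same_card[OF this]
  show "finite (carrier_vec n :: 'a vec set)" "card (carrier_vec n :: 'a vec set) = CARD('a) ^ n"
    by (simp_all add: finite_PiE card_funcsetE)
qed

lemma finite_mat: "finite (carrier_mat n m :: 'a::finite mat set)"
proof -
  have "carrier_mat n m \<subseteq> (\<lambda>f. mat n m f) ` ({..<n} \<times> {..<m} \<rightarrow>\<^sub>E (UNIV :: 'a set))"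
  proof
    fix A :: "'a mat" assume "A \<in> carrier_mat n m"
    then show "A \<in> (\<lambda>f. mat n m f) ` ({..<n} \<times> {..<m} \<rightarrow>\<^sub>E (UNIV :: 'a set))"
      by (intro image_eqI[where x = "restrict (\<lambda>ij. A $$ ij) ({..<n} \<times> {..<m})"]) (auto intro!: eq_matI)
  qed
  then show ?thesis
    by (rule finite_subset) (intro finite_imageI finite_PiE, auto)
qed

lemma finite_mat_range: "finite (mat_range (A :: 'a::{finite,field} mat))"
  unfolding mat_range_def by (intro finite_imageI finite_vec)

lemma mat_range_carrier: "A \<in> carrier_mat n m \<Longrightarrow> mat_range A \<subseteq> carrier_vec n"
  by (auto simp: mat_range_def)

lemma mat_range_add:
  assumes "u \<in> mat_range A" "v \<in> mat_range A"
  shows "u + v \<in> mat_range A"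
proof -
  obtain x y where "x \<in> carrier_vec (dim_col A)" "u = A *\<^sub>v x" "y \<in> carrier_vec (dim_col A)" "v = A *\<^sub>v y"
    using assms by (auto simp: mat_range_def)
  then have "u + v = A *\<^sub>v (x + y)" "x + y \<in> carrier_vec (dim_col A)"
    by (auto simp: mult_add_distrib_mat_vec[of A "dim_row A" "dim_col A"])
  then show ?thesis
    by (auto simp: mat_range_def)
qed

lemma mat_range_smult:
  assumes "u \<in> mat_range A"
  shows "c \<cdot>\<^sub>v u \<in> mat_range A"
proof -
  obtain x where "x \<in> carrier_vec (dim_col A)" "u = A *\<^sub>v x"
    using assms by (auto simp: mat_range_def)
  then have "c \<cdot>\<^sub>v u = A *\<^sub>v (c \<cdot>\<^sub>v x)" "c \<cdot>\<^sub>v x \<in> carrier_vec (dim_col A)"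
    by (auto simp: mult_mat_vec[of A "dim_row A" "dim_col A"])
  then show ?thesis
    by (auto simp: mat_range_def)
qed

lemma mat_range_diff:
  assumes A: "A \<in> carrier_mat n m" and uv: "u \<in> mat_range A" "v \<in> mat_range A"
  shows "u - v \<in> mat_range A"
proof -
  have "u \<in> carrier_vec n" "v \<in> carrier_vec n"
    using uv mat_range_carrier[OF A] by auto
  then have "u - v = u + (- 1) \<cdot>\<^sub>v v"
    by (intro eq_vecI) auto
  then show ?thesis
    using mat_range_add[OF uv(1) mat_range_smult[OF uv(2), of "- 1"]] by simp
qed

text \<open>\<open>Q\<close> only restricts the arguments fed to \<open>A\<close>, and
  \<open>P\<close> maps the resulting vectors on; hence the new range lies in the image under
  \<open>P\<close> of the range of \<open>A\<close>.\<close>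

lemma mat_rank_mult_le:
  fixes A :: "'a::{finite,field} mat"
  assumes P: "P \<in> carrier_mat n n" and A: "A \<in> carrier_mat n m" and Q: "Q \<in> carrier_mat m m"
  shows "mat_rank (P * A * Q) \<le> mat_rank A"
proof -
  have "mat_range (P * A * Q) \<subseteq> (\<lambda>v. P *\<^sub>v v) ` mat_range A"
  proof
    fix y assume "y \<in> mat_range (P * A * Q)"
    then obtain x where x: "x \<in> carrier_vec m" "y = P * A * Q *\<^sub>v x"
      using Q by (auto simp: mat_range_def)
    then have "y = P *\<^sub>v (A *\<^sub>v (Q *\<^sub>v x))"
      using assoc_mult_mat_vec[of "P * A" n m Q m x] assoc_mult_mat_vec[of P n n A m "Q *\<^sub>v x"] P A Q x by auto
    moreover have "A *\<^sub>v (Q *\<^sub>v x) \<in> mat_range A"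
      using A Q x by (auto simp: mat_range_def)
    ultimately show "y \<in> (\<lambda>v. P *\<^sub>v v) ` mat_range A"
      by blast
  qed
  then have "card (mat_range (P * A * Q)) \<le> card (mat_range A)"
    using surj_card_le[OF finite_mat_range] by blast
  then show ?thesis
    unfolding mat_rank_le_iff card_mat_range by simp
qed

text \<open>The scalar can be moved onto the argument, so the range can only shrink; this covers
  \<open>c = 0\<close> as well.\<close>

lemma mat_rank_smult_le:
  fixes A :: "'a::{finite,field} mat"
  shows "mat_rank (c \<cdot>\<^sub>m A) \<le> mat_rank A"
proof -
  have "(c \<cdot>\<^sub>m A) *\<^sub>v x = A *\<^sub>v (c \<cdot>\<^sub>v x)" if "x \<in> carrier_vec (dim_col A)" for x
    using that by (intro eq_vecI) auto
  then have "mat_range (c \<cdot>\<^sub>m A) \<subseteq> mat_range A"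
    by (auto simp: mat_range_def)
  then have "card (mat_range (c \<cdot>\<^sub>m A)) \<le> card (mat_range A)"
    by (rule card_mono[OF finite_mat_range])
  then show ?thesis
    unfolding mat_rank_le_iff card_mat_range by simp
qed

section \<open>Replacing a column\<close>

definition set_col :: "'a mat \<Rightarrow> nat \<Rightarrow> 'a vec \<Rightarrow> 'a mat" where
  "set_col A j x = mat (dim_row A) (dim_col A) (\<lambda>(i, k). if k = j then x $ i else A $$ (i, k))"

lemma set_col_carrier [simp]: "A \<in> carrier_mat n m \<Longrightarrow> set_col A j x \<in> carrier_mat n m"
  by (auto simp: set_col_def)

lemma dim_set_col [simp]: "dim_row (set_col A j x) = dim_row A" "dim_col (set_col A j x) = dim_col A"
  by (auto simp: set_col_def)

lemma set_col_set_col [simp]: "set_col (set_col A j x) j y = set_col A j y"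
  by (rule eq_matI) (auto simp: set_col_def)

lemma set_col_col: "j < dim_col A \<Longrightarrow> set_col A j (col A j) = A"
  by (rule eq_matI) (auto simp: set_col_def)

lemma col_set_col: "A \<in> carrier_mat n m \<Longrightarrow> j < m \<Longrightarrow> x \<in> carrier_vec n \<Longrightarrow> col (set_col A j x) j = x"
  by (rule eq_vecI) (auto simp: set_col_def)

text \<open>Isolates the contribution of column \<open>j\<close>: the remaining columns act as the
  matrix whose column \<open>j\<close> is blanked out.\<close>

lemma set_col_mult_vec:
  fixes A :: "'a::field mat"
  assumes A: "A \<in> carrier_mat n m" and j: "j < m" and x: "x \<in> carrier_vec n" and v: "v \<in> carrier_vec m"
  shows "set_col A j x *\<^sub>v v = set_col A j (0\<^sub>v n) *\<^sub>v v + v $ j \<cdot>\<^sub>v x"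
proof (rule eq_vecI)
  fix i assume "i < dim_vec (set_col A j (0\<^sub>v n) *\<^sub>v v + v $ j \<cdot>\<^sub>v x)"
  then have i: "i < n" using x by simp
  have "(set_col A j x *\<^sub>v v) $ i = (\<Sum>k<m. (if k = j then x $ i else A $$ (i, k)) * v $ k)"
    using A v i by (simp add: set_col_def scalar_prod_def lessThan_atLeast0)
  also have "\<dots> = (\<Sum>k<m. (if k = j then 0 else A $$ (i, k)) * v $ k + (if k = j then v $ j * x $ i else 0))"
    by (intro sum.cong) auto
  also have "\<dots> = (\<Sum>k<m. (if k = j then 0 else A $$ (i, k)) * v $ k) + v $ j * x $ i"
    using j by (simp add: sum.distrib)
  also have "(\<Sum>k<m. (if k = j then 0 else A $$ (i, k)) * v $ k) = (set_col A j (0\<^sub>v n) *\<^sub>v v) $ i"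
    using A v i by (auto simp: set_col_def scalar_prod_def lessThan_atLeast0 intro!: sum.cong)
  finally show "(set_col A j x *\<^sub>v v) $ i = (set_col A j (0\<^sub>v n) *\<^sub>v v + v $ j \<cdot>\<^sub>v x) $ i"
    using i x by simp
qed (use A x in \<open>simp add: set_col_def\<close>)

text \<open>The range is the sum of the span of the other columns and the line through
  \<open>x\<close>.\<close>

lemma mat_range_set_col:
  fixes A :: "'a::field mat"
  assumes A: "A \<in> carrier_mat n m" and j: "j < m" and x: "x \<in> carrier_vec n"
  shows "mat_range (set_col A j x) = (\<lambda>(c, u). u + c \<cdot>\<^sub>v x) ` (UNIV \<times> mat_range (set_col A j (0\<^sub>v n)))"
    (is "?L = ?R")
proof
  show "?L \<subseteq> ?R"
  proof
    fix y assume "y \<in> ?L"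
    then obtain v where v: "v \<in> carrier_vec m" "y = set_col A j x *\<^sub>v v"
      using A by (auto simp: mat_range_def)
    moreover have "set_col A j (0\<^sub>v n) *\<^sub>v v \<in> mat_range (set_col A j (0\<^sub>v n))"
      using v A by (auto simp: mat_range_def)
    ultimately show "y \<in> ?R"
      using set_col_mult_vec[OF A j x v(1)] by (intro image_eqI[where x = "(v $ j, set_col A j (0\<^sub>v n) *\<^sub>v v)"]) auto
  qed
  show "?R \<subseteq> ?L"
  proof clarify
    fix c u assume "u \<in> mat_range (set_col A j (0\<^sub>v n))"
    then obtain v where v: "v \<in> carrier_vec m" "u = set_col A j (0\<^sub>v n) *\<^sub>v v"
      using A by (auto simp: mat_range_def)
    \<comment> \<open>The coefficient of column \<open>j\<close> can be reset to \<open>c\<close>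
      freely, since the blanked matrix ignores it.\<close>
    define w where "w = vec m (\<lambda>k. if k = j then c else v $ k)"
    have w: "w \<in> carrier_vec m" "w $ j = c"
      using j by (auto simp: w_def)
    have "set_col A j (0\<^sub>v n) *\<^sub>v w = u"
      using A v(1) by (auto simp: v(2) w_def set_col_def scalar_prod_def intro!: eq_vecI sum.cong)
    then have "u + c \<cdot>\<^sub>v x = set_col A j x *\<^sub>v w"
      using set_col_mult_vec[OF A j x w(1)] w(2) by simp
    then show "u + c \<cdot>\<^sub>v x \<in> ?L"
      using w(1) A by (auto simp: mat_range_def)
  qed
qed

text \<open>If \<open>x\<close> lies in the span \<open>U\<close> of the other columns, the range
  stays \<open>U\<close>; otherwise the sum of \<open>U\<close> and the line through
  \<open>x\<close> is direct and has \<open>CARD('a)\<close> times as many elements.\<close>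

lemma card_mat_range_set_col:
  fixes A :: "'a::{finite,field} mat"
  assumes A: "A \<in> carrier_mat n m" and j: "j < m" and x: "x \<in> carrier_vec n"
  defines "U \<equiv> mat_range (set_col A j (0\<^sub>v n))"
  shows "card (mat_range (set_col A j x)) = (if x \<in> U then card U else CARD('a) * card U)"
proof -
  have A0: "set_col A j (0\<^sub>v n) \<in> carrier_mat n m"
    using A by simp
  have UV: "U \<subseteq> carrier_vec n"
    using mat_range_carrier[OF A0] by (simp add: U_def)
  let ?f = "\<lambda>(c :: 'a, u). u + c \<cdot>\<^sub>v x"
  have R: "mat_range (set_col A j x) = ?f ` (UNIV \<times> U)"
    unfolding U_def by (rule mat_range_set_col[OF A j x])
  show ?thesis
  proof (cases "x \<in> U")
    case True
    have "?f ` (UNIV \<times> U) = U"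
    proof
      show "?f ` (UNIV \<times> U) \<subseteq> U"
        using True by (auto simp: U_def intro: mat_range_add mat_range_smult)
      show "U \<subseteq> ?f ` (UNIV \<times> U)"
      proof
        fix u assume u: "u \<in> U"
        then have "u = ?f (0, u)"
          using UV x by (intro eq_vecI) auto
        then show "u \<in> ?f ` (UNIV \<times> U)"
          using u by blast
      qed
    qed
    then show ?thesis using R True by simp
  next
    case False
    have "inj_on ?f (UNIV \<times> U)"
    proof (intro inj_onI, clarify)
      fix c d u w assume u: "u \<in> U" and w: "w \<in> U" and eq: "u + c \<cdot>\<^sub>v x = w + d \<cdot>\<^sub>v x"
      have uw: "u \<in> carrier_vec n" "w \<in> carrier_vec n"
        using u w UV by auto
      have e: "u $ i + c * x $ i = w $ i + d * x $ i" if "i < n" for i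
        using arg_cong[OF eq, of "\<lambda>y. y $ i"] that uw x by simp
      have cd: "c = d"
      proof (rule ccontr)
        assume "c \<noteq> d"
        \<comment> \<open>Two representations with different coefficients could be solved for
          \<open>x\<close>, placing it in \<open>U\<close>.\<close>
        then have "x = inverse (c - d) \<cdot>\<^sub>v (w - u)"
          using uw x e by (intro eq_vecI) (auto simp: field_simps)
        moreover have "\<dots> \<in> U"
          using u w mat_range_diff[OF A0] unfolding U_def by (intro mat_range_smult) auto
        ultimately show False
          using False by simp
      qed
      moreover have "u = w"
        using e uw cd by (intro eq_vecI) auto
      ultimately show "c = d \<and> u = w" by simp
    qed
    then show ?thesis
      using R False by (simp add: card_image card_cartesian_product)
  qed
qed

text \<open>If \<open>x\<close> or \<open>y\<close> lies outside \<open>U\<close>, then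
  \<open>CARD('a) * card U\<close> already respects the bound and every column is admissible.
  Otherwise both lie in the subspace \<open>U\<close>, hence so does their difference.\<close>

lemma mat_rank_set_col_diff:
  fixes A :: "'a::{finite,field} mat"
  assumes A: "A \<in> carrier_mat n m" and j: "j < m"
    and x: "x \<in> carrier_vec n" "mat_rank (set_col A j x) \<le> t"
    and y: "y \<in> carrier_vec n" "mat_rank (set_col A j y) \<le> t"
  shows "mat_rank (set_col A j (x - y)) \<le> t"
proof -
  define U where "U = mat_range (set_col A j (0\<^sub>v n))"
  have "card U \<le> CARD('a) * card U"
    using card_field_gt_1[where 'a='a] by simp
  then have le: "card U \<le> CARD('a) ^ t" if "CARD('a) * card U \<le> CARD('a) ^ t"
    using that by linarith
  have xy: "x - y \<in> carrier_vec n"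
    using x(1) y(1) by simp
  have "x - y \<in> U" if "x \<in> U" "y \<in> U"
    using that mat_range_diff[of "set_col A j (0\<^sub>v n)" n m] A by (auto simp: U_def)
  then show ?thesis
    using x(2) y(2) le
    unfolding mat_rank_le_iff card_mat_range_set_col[OF A j x(1)] card_mat_range_set_col[OF A j y(1)]
      card_mat_range_set_col[OF A j xy] U_def[symmetric]
    by (auto split: if_splits)
qed


section \<open>Comparing the zeros of a linear form with those of one of its columns\<close>

definition rank_le_mats :: "nat \<Rightarrow> nat \<Rightarrow> nat \<Rightarrow> 'a::field mat set" where
  "rank_le_mats t l m = {M \<in> carrier_mat l m. mat_rank M \<le> t}"

lemma finite_rank_le_mats: "finite (rank_le_mats t l m :: 'a::{finite,field} mat set)"
  unfolding rank_le_mats_def by (rule finite_subset[OF _ finite_mat]) auto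

text \<open>Once the other columns are fixed, the first summand is a constant and the form becomes
  an affine function of column \<open>j\<close>.\<close>

lemma lin_form_eq_set_col:
  assumes F: "F \<in> carrier_mat l m" and M: "M \<in> carrier_mat l m" and j: "j < m"
  shows "lin_form F M = lin_form F (set_col M j (0\<^sub>v l)) + col F j \<bullet> col M j"
proof -
  have "lin_form F M = (\<Sum>i<l. \<Sum>k<m. F $$ (i, k) * M $$ (i, k))"
    using F by (simp add: lin_form_def)
  also have "\<dots> = (\<Sum>i<l. \<Sum>k<m. F $$ (i, k) * (if k = j then 0 else M $$ (i, k)) +
      (if k = j then F $$ (i, j) * M $$ (i, j) else 0))"
    by (intro sum.cong refl) simp
  also have "\<dots> = (\<Sum>i<l. (\<Sum>k<m. F $$ (i, k) * (if k = j then 0 else M $$ (i, k))) + F $$ (i, j) * M $$ (i, j))"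
    using j by (simp add: sum.distrib)
  also have "\<dots> = (\<Sum>i<l. \<Sum>k<m. F $$ (i, k) * (if k = j then 0 else M $$ (i, k))) + (\<Sum>i<l. F $$ (i, j) * M $$ (i, j))"
    by (rule sum.distrib)
  also have "(\<Sum>i<l. \<Sum>k<m. F $$ (i, k) * (if k = j then 0 else M $$ (i, k))) = lin_form F (set_col M j (0\<^sub>v l))"
    using F M by (auto simp: lin_form_def set_col_def intro!: sum.cong)
  also have "(\<Sum>i<l. F $$ (i, j) * M $$ (i, j)) = col F j \<bullet> col M j"
    using F M j by (auto simp: scalar_prod_def lessThan_atLeast0 intro!: sum.cong)
  finally show ?thesis .
qed

lemma minus_right_cancel_vec:
  fixes u v w :: "'a::group_add vec"
  assumes "u \<in> carrier_vec n" "v \<in> carrier_vec n" "w \<in> carrier_vec n" and eq: "u - w = v - w"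
  shows "u = v"
proof (rule eq_vecI)
  fix i assume "i < dim_vec v"
  then show "u $ i = v $ i"
    using arg_cong[OF eq, of "\<lambda>x. x $ i"] assms(1-3) by simp (metis diff_add_cancel)
qed (use assms in simp)

lemma card_eq_sum_fibres:
  assumes "finite A" "finite B" "g ` A \<subseteq> B"
  shows "card A = (\<Sum>b\<in>B. card {a \<in> A. g a = b})"
  using sum.group[OF assms, of "\<lambda>_. 1 :: nat"] by simp

text \<open>
  With all columns but the \<open>j\<close>-th fixed, the admissible \<open>j\<close>-th columns are closed under differences.
  So the solutions of an inhomogeneous linear equation among them, translated by one solution,
  become solutions of the homogeneous equation.
\<close>
lemma card_lin_form_zero_le:
  fixes F :: "'a::{finite,field} mat"
  assumes F: "F \<in> carrier_mat l m" and j: "j < m"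
  shows "card {M \<in> rank_le_mats t l m. lin_form F M = 0}
    \<le> card {M \<in> rank_le_mats t l m. col F j \<bullet> col M j = 0}" (is "card ?X \<le> card ?Y")
proof -
  let ?R = "rank_le_mats t l m :: 'a mat set"
  \<comment> \<open>Blanking column \<open>j\<close> records all other columns, so the fibres of
    \<open>?g\<close> are the families in which only column \<open>j\<close> varies. The inequality
    is proved fibre by fibre.\<close>
  let ?g = "\<lambda>M :: 'a mat. set_col M j (0\<^sub>v l)"
  have fin: "finite ?R" "finite ?X" "finite ?Y" "finite (?g ` ?R)"
    using finite_rank_le_mats[of t l m, where 'a='a] by auto
  have "card {M \<in> ?X. ?g M = b} \<le> card {M \<in> ?Y. ?g M = b}" for b
  proof (cases "{M \<in> ?X. ?g M = b} = {}")
    case False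
    then obtain N where N: "N \<in> ?R" "lin_form F N = 0" "?g N = b"
      by blast
    have Nc: "N \<in> carrier_mat l m"
      using N(1) by (simp add: rank_le_mats_def)
    have b: "b \<in> carrier_mat l m"
      using N(3) Nc by auto
    have M: "M \<in> carrier_mat l m" "mat_rank M \<le> t" "col M j \<in> carrier_vec l" "M = set_col b j (col M j)"
        "lin_form F b + col F j \<bullet> col M j = 0"
      if "M \<in> ?X" "?g M = b" for M
    proof -
      show Mc: "M \<in> carrier_mat l m" and "mat_rank M \<le> t"
        using that by (auto simp: rank_le_mats_def)
      then show "col M j \<in> carrier_vec l" by auto
      show "M = set_col b j (col M j)"
        unfolding that(2)[symmetric] using Mc j by (simp add: set_col_col)
      show "lin_form F b + col F j \<bullet> col M j = 0"
        unfolding that(2)[symmetric] using lin_form_eq_set_col[OF F Mc j] that(1) by simp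
    qed
    let ?h = "\<lambda>M. set_col b j (col M j - col N j)"
    have "inj_on ?h {M \<in> ?X. ?g M = b}"
    proof (rule inj_onI)
      fix M M' assume MM: "M \<in> {M \<in> ?X. ?g M = b}" "M' \<in> {M \<in> ?X. ?g M = b}" and eq: "?h M = ?h M'"
      have c: "col M j \<in> carrier_vec l" "col M' j \<in> carrier_vec l" "col N j \<in> carrier_vec l"
        using M(3)[of M] M(3)[of M'] MM Nc by auto
      have "col (?h M) j = col M j - col N j" "col (?h M') j = col M' j - col N j"
        using c by (auto intro!: col_set_col[OF b j])
      then have e: "col M j - col N j = col M' j - col N j"
        unfolding eq by (rule trans[OF sym])
      from c e have cols: "col M j = col M' j"
        by (rule minus_right_cancel_vec)
      have "M = set_col b j (col M j)" "M' = set_col b j (col M' j)"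
        using M(4)[of M] M(4)[of M'] MM by blast+
      then show "M = M'"
        unfolding cols by (rule trans[OF _ sym])
    qed
    moreover have "?h ` {M \<in> ?X. ?g M = b} \<subseteq> {M \<in> ?Y. ?g M = b}"
    proof
      fix K assume "K \<in> ?h ` {M \<in> ?X. ?g M = b}"
      then obtain L where L: "L \<in> ?X" "?g L = b" and K: "K = ?h L"
        by blast
      note L' = M[OF L]
      have Nx: "col N j \<in> carrier_vec l" using Nc by auto
      have rN: "mat_rank (set_col b j (col N j)) \<le> t" "lin_form F b + col F j \<bullet> col N j = 0"
        using M(2)[of N] M(4)[of N, symmetric] M(5)[of N] N by auto
      have rL: "mat_rank (set_col b j (col L j)) \<le> t"
        using L'(2) L'(4)[symmetric] by simp
      have "mat_rank K \<le> t"
        unfolding K by (rule mat_rank_set_col_diff[OF b j L'(3) rL Nx rN(1)])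
      moreover have "col K j = col L j - col N j"
        unfolding K using L'(3) Nx by (intro col_set_col[OF b j]) auto
      \<comment> \<open>The affine equations for \<open>L\<close> and \<open>N\<close> have the same
        constant \<open>lin_form F b\<close>, which cancels in their difference.\<close>
      moreover have "col F j \<bullet> (col L j - col N j) = 0"
        using rN(2) L'(3,5) Nx F by (subst scalar_prod_minus_distrib[of _ l]) (auto simp: add_eq_0_iff)
      moreover have "?g K = b"
        unfolding K using N(3) by auto
      moreover have "K \<in> carrier_mat l m"
        using b K by simp
      ultimately show "K \<in> {M \<in> ?Y. ?g M = b}"
        by (simp add: rank_le_mats_def)
    qed
    moreover have "finite {M \<in> ?Y. ?g M = b}"
      by (rule finite_subset[OF _ fin(3)]) auto
    ultimately show ?thesis
      by (rule card_inj_on_le)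
  next
    case True
    show ?thesis
      unfolding True by simp
  qed
  then have "(\<Sum>b\<in>?g ` ?R. card {M \<in> ?X. ?g M = b}) \<le> (\<Sum>b\<in>?g ` ?R. card {M \<in> ?Y. ?g M = b})"
    by (rule sum_mono)
  moreover have "card ?X = (\<Sum>b\<in>?g ` ?R. card {M \<in> ?X. ?g M = b})"
    using fin(2,4) by (rule card_eq_sum_fibres) auto
  moreover have "card ?Y = (\<Sum>b\<in>?g ` ?R. card {M \<in> ?Y. ?g M = b})"
    using fin(3,4) by (rule card_eq_sum_fibres) auto
  ultimately show ?thesis
    by argo
qed

text \<open>Taking complements in the common finite set \<open>rank_le_mats t l m\<close> turns the
  upper bound on zeros into a lower bound on nonzeros.\<close>

lemma card_lin_form_nonzero_ge:
  fixes F :: "'a::{finite,field} mat"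
  assumes F: "F \<in> carrier_mat l m" and j: "j < m"
  shows "card {M \<in> rank_le_mats t l m. col F j \<bullet> col M j \<noteq> 0}
    \<le> card {M \<in> rank_le_mats t l m. lin_form F M \<noteq> 0}"
proof -
  let ?R = "rank_le_mats t l m :: 'a mat set"
  have *: "card {M \<in> ?R. P M} + card {M \<in> ?R. \<not> P M} = card ?R" for P
    using finite_rank_le_mats[of t l m, where 'a='a]
    by (subst card_Un_disjoint[symmetric]) (auto intro: arg_cong[where f=card])
  show ?thesis
    using *[of "\<lambda>M. lin_form F M = 0"] *[of "\<lambda>M. col F j \<bullet> col M j = 0"] card_lin_form_zero_le[OF assms, of t]
    by linarith
qed

section \<open>Reduction to a single matrix entry\<close>

text \<open>Complete \<open>v\<close> to a basis that starts with \<open>v\<close>. The matrix with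
  these columns has full rank, hence nonzero determinant and an inverse.\<close>

lemma exists_invertible_first_col:
  fixes v :: "'a::field vec"
  assumes v: "v \<in> carrier_vec n" "v \<noteq> 0\<^sub>v n"
  obtains A B where "A \<in> carrier_mat n n" "B \<in> carrier_mat n n" "A * B = 1\<^sub>m n" "B * A = 1\<^sub>m n" "col A 0 = v"
proof -
  interpret vec_space "TYPE('a)" n .
  let ?b = "basis_completion v"
  note b = basis_completion[OF v]
  define A where "A = mat_of_cols n ?b"
  have A: "A \<in> carrier_mat n n"
    using b(6) by (auto simp: A_def)
  have cols: "cols A = ?b"
    using b(2) by (simp add: A_def cols_mat_of_cols)
  have n: "0 < n"
    using v by (cases n) auto
  have "col A 0 = v"
    using b(6,7) n A by (metis cols cols_nth carrier_matD(2) hd_conv_nth length_greater_0_conv)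
  moreover have "det A \<noteq> 0"
    using lin_indpt_full_rank[OF A] det_rank_iff[OF A] b(4,5) cols by simp
  from det_non_zero_imp_unit[OF A this, of "()"]
  obtain B where "B \<in> carrier_mat n n" "A * B = 1\<^sub>m n" "B * A = 1\<^sub>m n"
    unfolding Units_def ring_mat_def by auto
  ultimately show ?thesis
    using A that by blast
qed

text \<open>Take invertible \<open>P\<close> with first row \<open>f\<close> and invertible
  \<open>Q\<close> with first column the \<open>j\<close>-th unit vector. Then the corner of
  \<open>P * N * Q\<close> is the product of \<open>f\<close> with column \<open>j\<close> of
  \<open>N\<close>, and the map from \<open>N\<close> to \<open>P * N * Q\<close> covers the
  left-hand set.\<close>

lemma card_corner_nonzero_le:
  fixes f :: "'a::{finite,field} vec"
  assumes f: "f \<in> carrier_vec l" "f \<noteq> 0\<^sub>v l" and j: "j < m"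
  shows "card {M \<in> rank_le_mats t l m. M $$ (0, 0) \<noteq> (0 :: 'a)} \<le> card {M \<in> rank_le_mats t l m. f \<bullet> col M j \<noteq> 0}"
    (is "card ?X \<le> card ?Y")
proof -
  obtain A B where A: "A \<in> carrier_mat l l" "B \<in> carrier_mat l l" "B * A = 1\<^sub>m l" "col A 0 = f"
    using exists_invertible_first_col[OF f] by metis
  have "unit_vec m j \<noteq> (0\<^sub>v m :: 'a vec)"
    using j by simp
  then obtain Q Q' :: "'a mat" where Q: "Q \<in> carrier_mat m m" "Q' \<in> carrier_mat m m" "Q' * Q = 1\<^sub>m m" "col Q 0 = unit_vec m j"
    using exists_invertible_first_col[of "unit_vec m j :: 'a vec" m] by (metis unit_vec_carrier)
  \<comment> \<open>Transposition moves \<open>f\<close> from the first column of \<open>A\<close>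
    to the first row of \<open>P\<close>.\<close>
  define P where "P = transpose_mat A"
  define P' where "P' = transpose_mat B"
  have l: "0 < l" and m: "0 < m"
    using f j by (cases l; auto)+
  have P: "P \<in> carrier_mat l l" "P' \<in> carrier_mat l l" "row P 0 = f"
    using A l by (auto simp: P_def P'_def)
  have PP: "P * P' = 1\<^sub>m l"
    using A(1-3) by (metis P_def P'_def transpose_mult transpose_one)
  have corner: "(P * N * Q) $$ (0, 0) = f \<bullet> col N j" if N: "N \<in> carrier_mat l m" for N
  proof -
    have "P * N * Q = P * (N * Q)"
      using P N Q by simp
    also have "\<dots> $$ (0, 0) = f \<bullet> col (N * Q) 0"
      using P N Q l m by simp
    also have "col (N * Q) 0 = N *\<^sub>v unit_vec m j"
      using col_mult2[OF N Q(1) m] Q(4) by simp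
    also have "\<dots> = col N j"
      using N j by (intro eq_vecI) auto
    finally show ?thesis .
  qed
  have "?X \<subseteq> (\<lambda>N. P * N * Q) ` ?Y"
  proof
    fix M assume "M \<in> ?X"
    then have M: "M \<in> carrier_mat l m" "mat_rank M \<le> t" "M $$ (0, 0) \<noteq> 0"
      by (auto simp: rank_le_mats_def)
    \<comment> \<open>The preimage of \<open>M\<close>; its rank is at most that of \<open>M\<close>
      because multiplication by square matrices does not raise the rank.\<close>
    define N where "N = P' * M * Q'"
    have N: "N \<in> carrier_mat l m"
      using P Q M by (simp add: N_def)
    have "P * N * Q = P * (N * Q)"
      by (rule assoc_mult_mat[OF P(1) N Q(1)])
    also have "N * Q = P' * M * (Q' * Q)"
      unfolding N_def by (rule assoc_mult_mat[OF mult_carrier_mat[OF P(2) M(1)] Q(2,1)])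
    also have "\<dots> = P' * M"
      unfolding Q(3) by (rule right_mult_one_mat[OF mult_carrier_mat[OF P(2) M(1)]])
    also have "P * (P' * M) = P * P' * M"
      by (rule assoc_mult_mat[OF P(1,2) M(1), symmetric])
    also have "\<dots> = M"
      unfolding PP by (rule left_mult_one_mat[OF M(1)])
    finally have eq: "P * N * Q = M" .
    have "mat_rank N \<le> t"
      unfolding N_def using mat_rank_mult_le[OF P(2) M(1) Q(2)] M(2) by linarith
    moreover have "f \<bullet> col N j \<noteq> 0"
      using corner[OF N] M(3) unfolding eq by simp
    ultimately have "N \<in> ?Y"
      using N by (simp add: rank_le_mats_def)
    then show "M \<in> (\<lambda>N. P * N * Q) ` ?Y"
      unfolding eq[symmetric] by (rule imageI)
  qed
  then show ?thesis
    using finite_rank_le_mats[of t l m, where 'a='a] by (intro surj_card_le) auto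
qed

section \<open>Schur complements\<close>

text \<open>The matrix with first row \<open>(a, r)\<close>, first column \<open>(a, c)\<close> and Schur complement \<open>S\<close> of the entry \<open>a\<close>.\<close>
definition border :: "'a::field \<Rightarrow> 'a vec \<Rightarrow> 'a vec \<Rightarrow> 'a mat \<Rightarrow> 'a mat" where
  "border a r c S = mat (Suc (dim_row S)) (Suc (dim_col S)) (\<lambda>(i, j).
     case i of 0 \<Rightarrow> vCons a r $ j
     | Suc i' \<Rightarrow> vCons (c $ i') (row S i' + (c $ i' / a) \<cdot>\<^sub>v r) $ j)"

lemma border_carrier [simp]: "S \<in> carrier_mat n k \<Longrightarrow> border a r c S \<in> carrier_mat (Suc n) (Suc k)"
  by (auto simp: border_def)

text \<open>With \<open>y = a * x + r \<bullet> v\<close> as first coordinate, the lower part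
  \<open>x * c + (r \<bullet> v / a) * c + S v\<close> collapses to
  \<open>(y / a) * c + S v\<close>. Thus \<open>x\<close> enters only through
  \<open>y\<close>.\<close>

lemma border_mult_vCons:
  assumes S: "S \<in> carrier_mat n k" and r: "r \<in> carrier_vec k" and c: "c \<in> carrier_vec n"
    and a: "a \<noteq> 0" and v: "v \<in> carrier_vec k"
  shows "border a r c S *\<^sub>v vCons x v =
    vCons (a * x + r \<bullet> v) (((a * x + r \<bullet> v) / a) \<cdot>\<^sub>v c + S *\<^sub>v v)"
proof (rule eq_vecI)
  fix i assume "i < dim_vec (vCons (a * x + r \<bullet> v) (((a * x + r \<bullet> v) / a) \<cdot>\<^sub>v c + S *\<^sub>v v))"
  then have i: "i < Suc n" using S by simp
  show "(border a r c S *\<^sub>v vCons x v) $ i =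
    vCons (a * x + r \<bullet> v) (((a * x + r \<bullet> v) / a) \<cdot>\<^sub>v c + S *\<^sub>v v) $ i"
  proof (cases i)
    case 0
    have "row (border a r c S) 0 = vCons a r"
      using S r by (intro eq_vecI) (auto simp: border_def)
    then show ?thesis
      using 0 S by (simp add: border_def)
  next
    case (Suc i')
    then have i': "i' < n" using i by simp
    have "row (border a r c S) i = vCons (c $ i') (row S i' + (c $ i' / a) \<cdot>\<^sub>v r)"
      using S r i' Suc by (intro eq_vecI) (auto simp: border_def)
    moreover have "(row S i' + (c $ i' / a) \<cdot>\<^sub>v r) \<bullet> v = row S i' \<bullet> v + c $ i' / a * (r \<bullet> v)"
      using S r v i' by (subst add_scalar_prod_distrib[of _ k]) auto
    ultimately show ?thesis
      using Suc i' S c a by (simp add: border_def field_simps)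
  qed
qed (use S c in \<open>simp add: border_def\<close>)

lemma vec_Suc_eq_vCons: "w \<in> carrier_vec (Suc n) \<Longrightarrow> \<exists>x v. v \<in> carrier_vec n \<and> w = vCons x v"
  by (cases w) auto

text \<open>A vector of the range is given by its first coordinate \<open>y\<close> and a vector
  \<open>s\<close> of the range of \<open>S\<close>. These are independent of each other, since
  \<open>x\<close> can be chosen to produce any \<open>y\<close>.\<close>

lemma card_mat_range_border:
  fixes S :: "'a::{finite,field} mat"
  assumes S: "S \<in> carrier_mat n k" and r: "r \<in> carrier_vec k" and c: "c \<in> carrier_vec n" and a: "a \<noteq> 0"
  shows "card (mat_range (border a r c S)) = CARD('a) * card (mat_range S)"
proof -
  let ?f = "\<lambda>(y, s). vCons y ((y / a) \<cdot>\<^sub>v c + s)"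
  have "mat_range (border a r c S) = ?f ` (UNIV \<times> mat_range S)"
  proof
    show "mat_range (border a r c S) \<subseteq> ?f ` (UNIV \<times> mat_range S)"
    proof
      fix y assume "y \<in> mat_range (border a r c S)"
      then obtain w where w: "w \<in> carrier_vec (Suc k)" "y = border a r c S *\<^sub>v w"
        using S by (auto simp: mat_range_def border_def)
      then obtain x v where v: "v \<in> carrier_vec k" "w = vCons x v"
        using vec_Suc_eq_vCons by blast
      then have "y = ?f (a * x + r \<bullet> v, S *\<^sub>v v)"
        using w border_mult_vCons[OF S r c a] by simp
      moreover have "S *\<^sub>v v \<in> mat_range S"
        using S v by (auto simp: mat_range_def)
      ultimately show "y \<in> ?f ` (UNIV \<times> mat_range S)"
        by blast
    qed
    show "?f ` (UNIV \<times> mat_range S) \<subseteq> mat_range (border a r c S)"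
    proof clarify
      fix y s assume "s \<in> mat_range S"
      then obtain v where v: "v \<in> carrier_vec k" "s = S *\<^sub>v v"
        using S by (auto simp: mat_range_def)
      \<comment> \<open>The argument \<open>x\<close> is obtained by solving
        \<open>a * x + r \<bullet> v = y\<close>.\<close>
      have "vCons y ((y / a) \<cdot>\<^sub>v c + s) = border a r c S *\<^sub>v vCons ((y - r \<bullet> v) / a) v"
        using border_mult_vCons[OF S r c a v(1), of "(y - r \<bullet> v) / a"] a v by simp
      then show "vCons y ((y / a) \<cdot>\<^sub>v c + s) \<in> mat_range (border a r c S)"
        using v S by (auto simp: mat_range_def border_def)
    qed
  qed
  moreover have "inj_on ?f (UNIV \<times> mat_range S)"
  proof (intro inj_onI, clarify)
    fix y s y' s' assume s: "s \<in> mat_range S" "s' \<in> mat_range S"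
      and "vCons y ((y / a) \<cdot>\<^sub>v c + s) = vCons y' ((y' / a) \<cdot>\<^sub>v c + s')"
    then have y: "y = y'" and e: "(y / a) \<cdot>\<^sub>v c + s = (y / a) \<cdot>\<^sub>v c + s'"
      by auto
    have d: "s \<in> carrier_vec n" "s' \<in> carrier_vec n"
      using s mat_range_carrier[OF S] by auto
    have "s = s'"
    proof (rule eq_vecI)
      fix i assume "i < dim_vec s'"
      then show "s $ i = s' $ i"
        using arg_cong[OF e, of "\<lambda>v. v $ i"] d c by simp
    qed (use d in simp)
    with y show "y = y' \<and> s = s'" by simp
  qed
  ultimately show ?thesis
    by (simp add: card_image card_cartesian_product)
qed

lemma mat_rank_border:
  fixes S :: "'a::{finite,field} mat"
  assumes "S \<in> carrier_mat n k" "r \<in> carrier_vec k" "c \<in> carrier_vec n" "a \<noteq> 0"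
  shows "mat_rank (border a r c S) = Suc (mat_rank S)"
proof -
  have "CARD('a) ^ mat_rank (border a r c S) = CARD('a) ^ Suc (mat_rank S)"
    using card_mat_range_border[OF assms] by (simp add: card_mat_range)
  then show ?thesis
    using card_field_gt_1[where 'a='a] power_inject_exp by blast
qed

text \<open>The Schur complement subtracts exactly the correction that \<open>border\<close> adds
  back. For a zero corner the quotient is 0 in both places, so the identity persists.\<close>

lemma border_cases:
  fixes M :: "'a::field mat"
  assumes M: "M \<in> carrier_mat (Suc n) (Suc k)"
  obtains r c S where "r \<in> carrier_vec k" "c \<in> carrier_vec n" "S \<in> carrier_mat n k"
    "M = border (M $$ (0, 0)) r c S"
proof -
  let ?a = "M $$ (0, 0)"
  let ?r = "vec k (\<lambda>j. M $$ (0, Suc j))"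
  let ?c = "vec n (\<lambda>i. M $$ (Suc i, 0))"
  let ?S = "mat n k (\<lambda>(i, j). M $$ (Suc i, Suc j) - ?c $ i / ?a * ?r $ j)"
  have "?r \<in> carrier_vec k" "?c \<in> carrier_vec n" "?S \<in> carrier_mat n k"
    by auto
  moreover have "M = border ?a ?r ?c ?S"
    using M by (intro eq_matI) (auto simp: border_def vec_index_vCons split: nat.splits)
  ultimately show ?thesis
    by (rule that)
qed

text \<open>Corner, first row and first column can be read off from the matrix; once they agree, the
  correction terms agree and cancel from the remaining entries.\<close>

lemma border_inject:
  fixes a a' :: "'a::field"
  assumes r: "r \<in> carrier_vec k" "r' \<in> carrier_vec k" and c: "c \<in> carrier_vec n" "c' \<in> carrier_vec n"
    and S: "S \<in> carrier_mat n k" "S' \<in> carrier_mat n k" and eq: "border a r c S = border a' r' c' S'"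
  shows "a = a'" "r = r'" "c = c'" "S = S'"
proof -
  note e = arg_cong[OF eq, of "\<lambda>M. M $$ p" for p]
  have a: "a = a'"
    using e[of "(0, 0)"] S by (simp add: border_def)
  have "r $ j = r' $ j" if "j < k" for j
    using e[of "(0, Suc j)"] S that by (simp add: border_def)
  then have r': "r = r'"
    using r by (intro eq_vecI) auto
  have "c $ i = c' $ i" if "i < n" for i
    using e[of "(Suc i, 0)"] S that by (simp add: border_def)
  then have c': "c = c'"
    using c by (intro eq_vecI) auto
  have "S $$ (i, j) = S' $$ (i, j)" if "i < n" "j < k" for i j
    using e[of "(Suc i, Suc j)"] S that a r' c' r by (simp add: border_def)
  then have "S = S'"
    using S by (intro eq_matI) auto
  with a r' c' show "a = a'" "r = r'" "c = c'" "S = S'"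
    by blast+
qed

lemma inj_on_border:
  "inj_on (\<lambda>(a, r, c, S). border a r c S) ((UNIV :: 'a::field set) \<times> carrier_vec k \<times> carrier_vec n \<times> carrier_mat n k)"
proof (rule inj_onI)
  fix x y :: "'a \<times> 'a vec \<times> 'a vec \<times> 'a mat"
  obtain a r c S a' r' c' S' where xy: "x = (a, r, c, S)" "y = (a', r', c', S')"
    by (metis prod_cases4)
  assume "x \<in> UNIV \<times> carrier_vec k \<times> carrier_vec n \<times> carrier_mat n k"
    "y \<in> UNIV \<times> carrier_vec k \<times> carrier_vec n \<times> carrier_mat n k"
    "(\<lambda>(a, r, c, S). border a r c S) x = (\<lambda>(a, r, c, S). border a r c S) y"
  then have "r \<in> carrier_vec k" "r' \<in> carrier_vec k" "c \<in> carrier_vec n" "c' \<in> carrier_vec n"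
    "S \<in> carrier_mat n k" "S' \<in> carrier_mat n k" "border a r c S = border a' r' c' S'"
    by (simp_all add: xy)
  from border_inject[OF this] show "x = y"
    by (simp add: xy)
qed

text \<open>The decomposition is bijective and lowers the rank by one: \<open>CARD('a) - 1\<close>
  corners, \<open>CARD('a) ^ k\<close> rows, \<open>CARD('a) ^ n\<close> columns, and a Schur
  complement of rank at most \<open>t\<close>.\<close>

lemma card_corner_nonzero:
  "card {M \<in> rank_le_mats (Suc t) (Suc n) (Suc k). M $$ (0, 0) \<noteq> (0 :: 'a::{finite,field})}
    = (CARD('a) - 1) * (CARD('a) ^ (n + k) * nu TYPE('a) t n k)"
proof -
  let ?f = "\<lambda>(a :: 'a, r, c, S). border a r c S"
  let ?D = "(UNIV - {0}) \<times> carrier_vec k \<times> carrier_vec n \<times> rank_le_mats t n k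
    :: ('a \<times> 'a vec \<times> 'a vec \<times> 'a mat) set"
  have "{M \<in> rank_le_mats (Suc t) (Suc n) (Suc k). M $$ (0, 0) \<noteq> (0 :: 'a)} = ?f ` ?D" (is "?X = _")
  proof
    show "?X \<subseteq> ?f ` ?D"
    proof
      fix M assume "M \<in> ?X"
      then have M: "M \<in> carrier_mat (Suc n) (Suc k)" "mat_rank M \<le> Suc t" "M $$ (0, 0) \<noteq> 0"
        by (auto simp: rank_le_mats_def)
      obtain r c S where *: "r \<in> carrier_vec k" "c \<in> carrier_vec n" "S \<in> carrier_mat n k"
          "M = border (M $$ (0, 0)) r c S"
        using border_cases[OF M(1)] by metis
      have "mat_rank S \<le> t"
        using mat_rank_border[OF *(3,1,2) M(3)] *(4) M(2) by simp
      then have "(M $$ (0, 0), r, c, S) \<in> ?D"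
        using * M(3) by (simp add: rank_le_mats_def)
      moreover have "M = ?f (M $$ (0, 0), r, c, S)"
        using *(4) by simp
      ultimately show "M \<in> ?f ` ?D"
        by (rule rev_image_eqI)
    qed
    show "?f ` ?D \<subseteq> ?X"
      by (auto simp: rank_le_mats_def mat_rank_border) (auto simp: border_def)
  qed
  moreover have "inj_on ?f ?D"
    by (rule inj_on_subset[OF inj_on_border[of k n]]) (auto simp: rank_le_mats_def)
  ultimately have "card ?X = card ?D"
    by (simp add: card_image)
  also have "\<dots> = (CARD('a) - 1) * (CARD('a) ^ k * (CARD('a) ^ n * nu TYPE('a) t n k))"
    by (simp add: card_cartesian_product card_vec card_Diff_subset nu_def rank_le_mats_def)
  finally show ?thesis
    by (simp add: power_add algebra_simps)
qed

section \<open>Passing to projective points\<close>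

text \<open>A nonzero entry of \<open>M\<close> tells its scalar multiples apart, so the point has
  one element per nonzero scalar.\<close>

lemma card_proj_point:
  fixes M :: "'a::{finite,field} mat"
  assumes "M \<in> carrier_mat l m" "M \<noteq> 0\<^sub>m l m"
  shows "card (proj_point M) = CARD('a) - 1"
proof -
  obtain i j where ij: "i < l" "j < m" "M $$ (i, j) \<noteq> 0"
    using assms by (metis eq_matI carrier_matD index_zero_mat)
  have "inj_on (\<lambda>c. c \<cdot>\<^sub>m M) (UNIV - {0})"
  proof (rule inj_onI)
    fix c d assume "c \<cdot>\<^sub>m M = d \<cdot>\<^sub>m M"
    then have "(c \<cdot>\<^sub>m M) $$ (i, j) = (d \<cdot>\<^sub>m M) $$ (i, j)" by simp
    then show "c = d" using ij assms(1) by simp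
  qed
  moreover have "proj_point M = (\<lambda>c. c \<cdot>\<^sub>m M) ` (UNIV - {0})"
    by (auto simp: proj_point_def)
  ultimately show ?thesis
    by (simp add: card_image card_Diff_subset)
qed

lemma self_in_proj_point: "M \<in> proj_point M"
proof -
  have "M = 1 \<cdot>\<^sub>m M"
    by (rule eq_matI) auto
  then show ?thesis
    unfolding proj_point_def by (smt (verit) mem_Collect_eq zero_neq_one)
qed

lemma proj_point_smult:
  fixes M :: "'a::field mat"
  assumes "c \<noteq> 0"
  shows "proj_point (c \<cdot>\<^sub>m M) = proj_point M"
proof -
  have *: "d \<cdot>\<^sub>m (c \<cdot>\<^sub>m M) = (d * c) \<cdot>\<^sub>m M" for d
    by (rule eq_matI) auto
  show ?thesis
  proof
    show "proj_point (c \<cdot>\<^sub>m M) \<subseteq> proj_point M"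
      using assms by (auto simp: proj_point_def *)
    show "proj_point M \<subseteq> proj_point (c \<cdot>\<^sub>m M)"
    proof
      fix N assume "N \<in> proj_point M"
      then obtain d where "N = d \<cdot>\<^sub>m M" "d \<noteq> 0"
        by (auto simp: proj_point_def)
      then have "N = (d / c) \<cdot>\<^sub>m (c \<cdot>\<^sub>m M)" "d / c \<noteq> 0"
        using assms by (simp_all add: *)
      then show "N \<in> proj_point (c \<cdot>\<^sub>m M)"
        by (auto simp: proj_point_def)
    qed
  qed
qed

text \<open>The arbitrary choice of representative changes the value of a linear form only by a
  nonzero factor, so it does not affect weights.\<close>

lemma rep_proj_point: "\<exists>c. c \<noteq> 0 \<and> rep (proj_point M) = c \<cdot>\<^sub>m M"
proof -
  have "rep (proj_point M) \<in> proj_point M"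
    unfolding rep_def using self_in_proj_point by (rule someI)
  then show ?thesis
    by (auto simp: proj_point_def)
qed

lemma lin_form_smult:
  assumes "F \<in> carrier_mat l m" "M \<in> carrier_mat l m"
  shows "lin_form F (c \<cdot>\<^sub>m M) = c * lin_form F M"
  using assms by (simp add: lin_form_def sum_distrib_left algebra_simps)

lemma lin_form_zero_right: "F \<in> carrier_mat l m \<Longrightarrow> lin_form F (0\<^sub>m l m) = 0"
  by (simp add: lin_form_def)

text \<open>Names the codeword of a given form, which \<open>det_code\<close> mentions only under an
  existential quantifier.\<close>

definition codeword :: "'a::{finite,field} itself \<Rightarrow> nat \<Rightarrow> nat \<Rightarrow> nat \<Rightarrow> 'a mat \<Rightarrow> 'a mat set \<Rightarrow> 'a" where
  "codeword ty t l m F = (\<lambda>P. if P \<in> det_points ty t l m then lin_form F (rep P) else 0)"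

lemma det_code_eq: "det_code ty t l m = codeword ty t l m ` carrier_mat l m"
  by (auto simp: det_code_def codeword_def)

text \<open>Weights count points, whereas the preceding counts are of matrices. Each point of the
  support consists of \<open>CARD('a) - 1\<close> matrices on which the form is nonzero, and the
  zero matrix is never among them.\<close>

lemma hweight_codeword:
  fixes F :: "'a::{finite,field} mat"
  assumes F: "F \<in> carrier_mat l m"
  shows "(CARD('a) - 1) * hweight TYPE('a) t l m (codeword TYPE('a) t l m F)
    = card {M \<in> rank_le_mats t l m. lin_form F M \<noteq> 0}"
proof -
  let ?W = "{M \<in> rank_le_mats t l m. lin_form F M \<noteq> 0}"
  have W: "M \<in> carrier_mat l m" "mat_rank M \<le> t" "lin_form F M \<noteq> 0" "M \<noteq> 0\<^sub>m l m" if "M \<in> ?W" for M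
    using that lin_form_zero_right[OF F] by (auto simp: rank_le_mats_def)
  have rep: "lin_form F (rep (proj_point M)) = 0 \<longleftrightarrow> lin_form F M = 0" if "M \<in> carrier_mat l m" for M
    using rep_proj_point[of M] lin_form_smult[OF F that] by force
  have supp: "{P \<in> det_points TYPE('a) t l m. codeword TYPE('a) t l m F P \<noteq> 0} = proj_point ` ?W"
  proof
    show "{P \<in> det_points TYPE('a) t l m. codeword TYPE('a) t l m F P \<noteq> 0} \<subseteq> proj_point ` ?W"
      using rep by (auto simp: det_points_def codeword_def rank_le_mats_def)
    show "proj_point ` ?W \<subseteq> {P \<in> det_points TYPE('a) t l m. codeword TYPE('a) t l m F P \<noteq> 0}"
    proof clarify
      fix M assume "M \<in> rank_le_mats t l m" "lin_form F M \<noteq> 0"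
      then have M: "M \<in> ?W" by simp
      then have "proj_point M \<in> det_points TYPE('a) t l m"
        using W[OF M] by (auto simp: det_points_def)
      then show "proj_point M \<in> det_points TYPE('a) t l m \<and> codeword TYPE('a) t l m F (proj_point M) \<noteq> 0"
        using rep W[OF M] by (simp add: codeword_def)
    qed
  qed
  \<comment> \<open>The fibre over a point is the point itself, because nonzero scalars preserve the
    rank bound and the nonvanishing of the form.\<close>
  have fibre: "card {M \<in> ?W. proj_point M = P} = CARD('a) - 1" if "P \<in> proj_point ` ?W" for P
  proof -
    obtain M where M: "M \<in> ?W" "P = proj_point M"
      using \<open>P \<in> proj_point ` ?W\<close> by blast
    have "{N \<in> ?W. proj_point N = P} = proj_point M"
    proof
      show "{N \<in> ?W. proj_point N = P} \<subseteq> proj_point M"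
        using self_in_proj_point M(2) by blast
      show "proj_point M \<subseteq> {N \<in> ?W. proj_point N = P}"
      proof
        fix N assume "N \<in> proj_point M"
        then obtain c where c: "N = c \<cdot>\<^sub>m M" "c \<noteq> 0"
          by (auto simp: proj_point_def)
        then show "N \<in> {N \<in> ?W. proj_point N = P}"
          using W[OF M(1)] M(2) proj_point_smult[of c M] lin_form_smult[OF F, of M c] mat_rank_smult_le[of c M]
          by (simp add: rank_le_mats_def)
      qed
    qed
    then show ?thesis
      using card_proj_point W[OF M(1)] by metis
  qed
  have fin: "finite ?W"
    using finite_rank_le_mats[of t l m, where 'a='a] by simp
  have "card ?W = (\<Sum>P\<in>proj_point ` ?W. card {M \<in> ?W. proj_point M = P})"
    using fin by (intro card_eq_sum_fibres) auto
  also have "\<dots> = card (proj_point ` ?W) * (CARD('a) - 1)"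
    using fibre by simp
  finally show ?thesis
    by (simp add: hweight_def supp mult.commute)
qed

section \<open>The lower bound for the weights and its attainment\<close>

lemma hweight_codeword_ge:
  fixes F :: "'a::{finite,field} mat"
  assumes F: "F \<in> carrier_mat (Suc n) (Suc k)" and F0: "F \<noteq> 0\<^sub>m (Suc n) (Suc k)"
  shows "CARD('a) ^ (n + k) * nu TYPE('a) t n k
    \<le> hweight TYPE('a) (Suc t) (Suc n) (Suc k) (codeword TYPE('a) (Suc t) (Suc n) (Suc k) F)"
proof -
  obtain i j where ij: "i < Suc n" "j < Suc k" "F $$ (i, j) \<noteq> 0"
    using F F0 by (metis eq_matI carrier_matD index_zero_mat)
  have "col F j $ i \<noteq> 0"
    using ij F by simp
  then have "col F j \<noteq> 0\<^sub>v (Suc n)"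
    using ij(1) by (metis index_zero_vec(1))
  then have "card {M \<in> rank_le_mats (Suc t) (Suc n) (Suc k). M $$ (0, 0) \<noteq> (0 :: 'a)}
      \<le> card {M \<in> rank_le_mats (Suc t) (Suc n) (Suc k). col F j \<bullet> col M j \<noteq> 0}"
    using F ij(2) by (intro card_corner_nonzero_le) auto
  also have "\<dots> \<le> card {M \<in> rank_le_mats (Suc t) (Suc n) (Suc k). lin_form F M \<noteq> 0}"
    by (rule card_lin_form_nonzero_ge[OF F ij(2)])
  \<comment> \<open>Both sides count matrices and carry the positive factor
    \<open>CARD('a) - 1\<close>, which cancels.\<close>
  finally show ?thesis
    unfolding card_corner_nonzero hweight_codeword[OF F, symmetric]
    using card_field_gt_1[where 'a='a] by simp
qed

text \<open>\<open>E\<close> is the form that returns the corner entry, so its nonzeros are exactly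
  the matrices of \<open>card_corner_nonzero\<close> and the lower bound is attained.\<close>

lemma hweight_codeword_corner:
  fixes n k :: nat
  defines "E \<equiv> mat (Suc n) (Suc k) (\<lambda>p. if p = (0, 0) then 1 else 0 :: 'a::{finite,field})"
  shows "hweight TYPE('a) (Suc t) (Suc n) (Suc k) (codeword TYPE('a) (Suc t) (Suc n) (Suc k) E)
    = CARD('a) ^ (n + k) * nu TYPE('a) t n k"
proof -
  have E: "E \<in> carrier_mat (Suc n) (Suc k)"
    by (simp add: E_def)
  have "lin_form E M = M $$ (0, 0)" for M
  proof -
    have "lin_form E M = (\<Sum>i<Suc n. \<Sum>j<Suc k. if j = 0 then (if i = 0 then M $$ (0, 0) else 0) else 0)"
      unfolding lin_form_def by (intro sum.cong) (auto simp: E_def)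
    also have "\<dots> = M $$ (0, 0)"
      by (simp only: sum.delta finite_lessThan lessThan_iff zero_less_Suc if_True)
    finally show ?thesis .
  qed
  then have "(CARD('a) - 1) * hweight TYPE('a) (Suc t) (Suc n) (Suc k) (codeword TYPE('a) (Suc t) (Suc n) (Suc k) E)
      = (CARD('a) - 1) * (CARD('a) ^ (n + k) * nu TYPE('a) t n k)"
    unfolding hweight_codeword[OF E] card_corner_nonzero[symmetric] by presburger
  then show ?thesis
    using card_field_gt_1[where 'a='a] by (metis mult_left_cancel not_less0 zero_less_diff)
qed

text \<open>The zero matrix is always counted. Positivity ensures that the codeword of the corner
  form is nonzero.\<close>

lemma nu_pos: "0 < nu TYPE('a::{finite,field}) t n k"
proof -
  have "mat_range (0\<^sub>m n k :: 'a mat) \<subseteq> {0\<^sub>v n}"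
    by (auto simp: mat_range_def)
  then have "card (mat_range (0\<^sub>m n k :: 'a mat)) \<le> 1"
    using card_mono[of "{0\<^sub>v n}" "mat_range (0\<^sub>m n k :: 'a mat)"] by simp
  also have "1 \<le> CARD('a) ^ t"
    by simp
  finally have "0\<^sub>m n k \<in> (rank_le_mats t n k :: 'a mat set)"
    unfolding rank_le_mats_def mat_rank_le_iff by simp
  then show ?thesis
    using finite_rank_le_mats[of t n k, where 'a='a]
    unfolding nu_def rank_le_mats_def[symmetric] by (metis card_gt_0_iff empty_iff)
qed

theorem mainTheorem6:
  fixes t l m :: nat
  assumes "1 \<le> t" and "t \<le> l" and "l \<le> m"
  shows "det_min_dist TYPE('a::{finite,field}) t l m
           = card (UNIV :: 'a set) ^ (l + m - 2) * nu TYPE('a) (t - 1) (l - 1) (m - 1)"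
proof -
  \<comment> \<open>Successors remove the truncated subtractions: \<open>l + m - 2\<close> becomes
    \<open>n + k\<close>.\<close>
  obtain t' n k where t: "t = Suc t'" and l: "l = Suc n" and m: "m = Suc k"
    using assms by (metis Suc_le_D One_nat_def order_trans)
  let ?C = "codeword TYPE('a) t l m"
  let ?w = "hweight TYPE('a) t l m"
  let ?d = "CARD('a) ^ (n + k) * nu TYPE('a) t' n k"
  have "Min {?w c | c. c \<in> det_code TYPE('a) t l m \<and> c \<noteq> (\<lambda>_. 0)} = ?d" (is "Min ?S = _")
  proof (rule Min_eqI)
    have "?S \<subseteq> ?w ` ?C ` carrier_mat l m"
      by (auto simp: det_code_eq)
    then show "finite ?S"
      by (rule finite_subset) (intro finite_imageI finite_mat)
  next
    fix d assume "d \<in> ?S"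
    then obtain F where F: "F \<in> carrier_mat l m" "?C F \<noteq> (\<lambda>_. 0)" "d = ?w (?C F)"
      by (auto simp: det_code_eq)
    \<comment> \<open>The zero form yields the zero codeword, so a nonzero codeword comes from a
      nonzero form.\<close>
    have "F \<noteq> 0\<^sub>m l m"
      using F(2) by (auto simp: codeword_def lin_form_def)
    then show "?d \<le> d"
      using hweight_codeword_ge[of F n k t'] F(1,3) t l m by simp
  next
    let ?E = "mat l m (\<lambda>p. if p = (0, 0) then 1 else 0 :: 'a)"
    have w: "?w (?C ?E) = ?d"
      using hweight_codeword_corner[of t' n k, where 'a='a] t l m by simp
    \<comment> \<open>Positive weight makes the corner codeword nonzero, so it belongs to the set
      being minimised.\<close>
    then have "?w (?C ?E) \<noteq> 0"
      using nu_pos[of t' n k, where 'a='a] by simp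
    then have "?C ?E \<noteq> (\<lambda>_. 0)"
      by (auto simp: hweight_def)
    then show "?d \<in> ?S"
      using w by (auto simp: det_code_eq intro!: exI[of _ "?C ?E"])
  qed
  then show ?thesis
    by (simp add: det_min_dist_def t l m)
qed

end
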